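(* There exists a domain $U$ in the three-dimensional extended hyperbolic space $\mathbb{K}^3$ which is $C^{1}$-transversal to $\partial\mathbb{H}^3$ and has infinite volume, i.e. $\left|\int_U dV_\epsilon\right|\to\infty$ as $\epsilon\to0^+$.
   Context: $\mathbb{K}^3=\{1\}\times\mathbb{R}^3\cong\mathbb{R}^3$ is the affine (Kleinian) model of the three-dimensional extended hyperbolic space: $\mathbb{H}^3$ is the open unit ball, the Lorentzian part $\mathbb{L}^3$ is the exterior of the closed unit ball, and $\partial\mathbb{H}^3$ is the unit sphere. For $\epsilon>0$ put $d_\epsilon=1-\epsilon i$ and $$dV_\epsilon=\frac{d_\epsilon\,dx_1\,dx_2\,dx_3}{(d_\epsilon^2-|x|^2)^{2}},$$ a complex-valued density on $\mathbb{K}^3$. The volume of a domain $U\subset\mathbb{K}^3$, possibly crossing $\partial\mathbb{H}^3$, is $\mu(U):=\lim_{\epsilon\to0^+}\int_U dV_\epsilon$. Transversality: a domain $U\subset\mathbb{K}^3$ with boundary $U^b$ is $C^{1}$-transversal to $\partial\mathbb{H}^3$ if for each point $p\in U^b\cap\partial\mathbb{H}^3$ there is a neighborhood $V$ of $p$ such that $U^b\cap V$ is the zero set of a single $C^{1}$ function (with nonvanishing differential on its zero set), and this $C^1$ surface is transversal to $\partial\mathbb{H}^3$ in the usual sense. *)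

theory Defs
  imports "HOL-Analysis.Analysis"
begin

text \<open>The affine model \<open>{1} \<times> \<real>\<^sup>3\<close> is identified with \<open>real^3\<close>.\<close>

type_synonym K3 = "real^3"

definition boundary_H3 :: "K3 set"
  where "boundary_H3 = sphere 0 1"

definition d_eps :: "real \<Rightarrow> complex"
  where "d_eps \<epsilon> = 1 - complex_of_real \<epsilon> * \<i>"

definition dV_density :: "real \<Rightarrow> K3 \<Rightarrow> complex"
  where "dV_density \<epsilon> x = d_eps \<epsilon> / ((d_eps \<epsilon>)^2 - complex_of_real ((norm x)^2))^2"

definition vol_eps :: "real \<Rightarrow> K3 set \<Rightarrow> complex"
  where "vol_eps \<epsilon> U = (LINT x:U|lborel. dV_density \<epsilon> x)"

text \<open>The Bochner integral of a non-integrable function is \<open>0\<close>, so this divergence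
  entails that the density is integrable over \<open>U\<close> for all small \<open>\<epsilon> > 0\<close>.\<close>

definition infinite_volume :: "K3 set \<Rightarrow> bool"
  where "infinite_volume U \<longleftrightarrow> filterlim (\<lambda>\<epsilon>. norm (vol_eps \<epsilon> U)) at_top (at_right 0)"

definition domain_K3 :: "K3 set \<Rightarrow> bool"
  where "domain_K3 U \<longleftrightarrow> open U \<and> connected U \<and> U \<noteq> {}"

definition C1_on :: "K3 set \<Rightarrow> (K3 \<Rightarrow> real) \<Rightarrow> bool"
  where "C1_on V F \<longleftrightarrow>
    (\<exists>F' :: K3 \<Rightarrow> K3 \<Rightarrow>\<^sub>L real.
      (\<forall>x\<in>V. (F has_derivative blinfun_apply (F' x)) (at x)) \<and> continuous_on V F')"

text \<open>The equation \<open>F = 0\<close> presents \<open>S\<close> as a regular \<open>C\<^sup>1\<close> surface inside \<open>V\<close>.\<close>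

definition regular_C1_equation :: "K3 set \<Rightarrow> K3 set \<Rightarrow> (K3 \<Rightarrow> real) \<Rightarrow> bool"
  where "regular_C1_equation S V F \<longleftrightarrow>
    C1_on V F \<and> S \<inter> V = {x \<in> V. F x = 0} \<and>
    (\<forall>x\<in>V. F x = 0 \<longrightarrow> frechet_derivative F (at x) \<noteq> (\<lambda>v. 0))"

text \<open>Tangent plane at \<open>q\<close> of the level set of \<open>F\<close> through \<open>q\<close>, for \<open>F\<close> regular at \<open>q\<close>.\<close>

definition tangent_plane :: "(K3 \<Rightarrow> real) \<Rightarrow> K3 \<Rightarrow> K3 set"
  where "tangent_plane F q = {v. frechet_derivative F (at q) v = 0}"

definition C1_transversal :: "K3 set \<Rightarrow> bool"
  where "C1_transversal U \<longleftrightarrow>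
    (\<forall>p \<in> frontier U \<inter> boundary_H3.
      \<exists>V F. open V \<and> p \<in> V \<and> regular_C1_equation (frontier U) V F \<and>
        (\<forall>q \<in> frontier U \<inter> V \<inter> boundary_H3.
          {u + v | u v. u \<in> tangent_plane F q \<and>
                        v \<in> tangent_plane (\<lambda>x. (norm x)^2 - 1) q} = UNIV))"

end

theory Submission
  imports Defs
begin

text \<open>
  A logarithmic loss of smoothness at the equator is enough. For a solid of revolution about the
  vertical axis, write the volume as an integral over the spheres \<open>\<bar>x\<bar>\<^sup>2 = s\<close>. If \<open>a s\<close> is the area
  function, the singular part is the integral of \<open>a s / (d\<^sub>\<epsilon>\<^sup>2 - s)\<^sup>2\<close>, which after integration by
  parts is the one of \<open>a' s / (s - 1)\<close> regularised at scale \<open>\<epsilon>\<close>. For a \<open>C\<^sup>1\<close> boundary \<open>a'\<close> is only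
  continuous: if it varies like \<open>1 / \<bar>ln (s - 1)\<bar>\<close> just outside the ball and much less just inside,
  nothing cancels and the integral diverges like \<open>ln \<bar>ln \<epsilon>\<bar>\<close>.

  Accordingly the region lies above the surface \<open>x $ 3 = f (\<bar>x\<bar>\<^sup>2 - 1)\<close> and inside \<open>\<bar>x\<bar>\<^sup>2 < 2\<close>, where
  \<open>f u = u / (1 - ln u)\<close> for \<open>u > 0\<close> and \<open>f u = 0\<close> otherwise. The function \<open>f\<close> is \<open>C\<^sup>1\<close>
  (\<open>profile_has_derivative\<close>), so the boundary is a regular \<open>C\<^sup>1\<close> surface that crosses the unit sphere
  orthogonally along the equator (\<open>C1_transversal_log_region\<close>); the outer boundary
  \<open>\<bar>x\<bar>\<^sup>2 = 2\<close> stays away from the unit sphere.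

  The volume is computed by horizontal slices instead of spheres, since these are discs on which the
  density integrates in closed form (\<open>inverse_square_integral_disc\<close>). At height \<open>z\<close> one gets
  \<open>\<pi> (d / (d\<^sup>2 - 1 - h) - d / (d\<^sup>2 - z\<^sup>2))\<close> with \<open>f h = z\<close> (\<open>slice_integral_inside\<close>). For
  \<open>\<epsilon> \<le> z \<le> 1\<close> the real part of the first term is comparable to \<open>- 1 / h\<close>, hence at most a constant multiple of
  \<open>- 1 / (z (1 - ln z))\<close>, and integrating this over \<open>\<epsilon> \<le> z \<le> 1\<close> gives a multiple of \<open>- ln (1 - ln \<epsilon>)\<close>. The second
  term contributes a quantity bounded above (\<open>Re_axis_term_ge\<close>). So the real part of the volume
  tends to \<open>- \<infinity>\<close> (\<open>Re_vol_eps_le\<close>).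
\<close>

section \<open>Integrating over horizontal slices\<close>

text \<open>Polar coordinates in the plane, in the variable \<open>- \<bar>y\<bar>\<^sup>2\<close>: a disc has area \<open>\<pi>\<close> times its squared
  radius. The sign makes the half-lines \<open>{x<..}\<close>, which determine a measure on the line, have
  finite mass.\<close>

lemma distr_neg_norm_sq_plane:
  "distr lborel borel (\<lambda>y::real \<times> real. - (norm y)\<^sup>2)
     = density lborel (\<lambda>w. ennreal (pi * indicator {..0} w))"
  (is "?M = ?N")
proof -
  have M: "emeasure ?M {x<..} = ennreal (pi * max 0 (- x))" for x
  proof -
    have "emeasure ?M {x<..} = emeasure lborel ((\<lambda>y::real \<times> real. - (norm y)\<^sup>2) -` {x<..} \<inter> space lborel)"
      by (rule emeasure_distr) auto
    also have "(\<lambda>y::real \<times> real. - (norm y)\<^sup>2) -` {x<..} \<inter> space lborel = ball 0 (sqrt (max 0 (- x)))"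
    proof -
      have "x < - (norm y)\<^sup>2 \<longleftrightarrow> norm y < sqrt (max 0 (- x))" for y :: "real \<times> real"
      proof (cases "x < 0")
        case True
        then show ?thesis using real_less_rsqrt[of "norm y" "-x"] real_sqrt_less_iff[of "(norm y)\<^sup>2" "-x"]
          by (auto simp: max_def)
      next
        case False
        then have "- (norm y)\<^sup>2 \<le> x" using zero_le_power2[of "norm y"] by linarith
        then show ?thesis using False by (auto simp: max_def not_less)
      qed
      then show ?thesis by auto
    qed
    also have "emeasure lborel (ball (0::real \<times> real) (sqrt (max 0 (- x)))) = ennreal (pi * max 0 (- x))"
      by (subst emeasure_ball) (auto simp: unit_ball_vol_2)
    finally show ?thesis .
  qed
  have N: "emeasure ?N {x<..} = ennreal (pi * max 0 (- x))" for x
  proof -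
    have "emeasure ?N {x<..} = (\<integral>\<^sup>+ w. ennreal (pi * indicator {..0} w) * indicator {x<..} w \<partial>lborel)"
      by (rule emeasure_density) auto
    also have "\<dots> = (\<integral>\<^sup>+ w. ennreal pi * indicator {x<..0} w \<partial>lborel)"
      by (rule nn_integral_cong) (auto simp: indicator_def)
    also have "\<dots> = ennreal pi * emeasure lborel {x<..0}"
      by (rule nn_integral_cmult_indicator) auto
    also have "\<dots> = ennreal (pi * max 0 (- x))"
      by (cases "x \<le> 0") (auto simp: max_def simp flip: ennreal_mult')
    finally show ?thesis .
  qed
  show ?thesis
    by (rule measure_eqI_lessThan) (auto simp: M N)
qed

text \<open>The hyperbolic density is the derivative, in the squared radius of the slice, of
  \<open>d / (c - w)\<close>; this is what makes horizontal slices of a solid of revolution explicit.\<close>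

lemma inverse_square_integral_disc:
  fixes c d :: complex
  assumes "Im c \<noteq> 0" "0 \<le> R"
  shows "(LINT y:{y :: real \<times> real. (norm y)\<^sup>2 < R}|lborel. d / (c - of_real ((norm y)\<^sup>2))\<^sup>2)
           = of_real pi * (d / (c - of_real R) - d / c)"
proof -
  let ?g = "\<lambda>w. d / (c + of_real w)\<^sup>2"
  have nz: "c + of_real w \<noteq> 0" for w
    using assms(1) by (auto simp: complex_eq_iff)
  have [measurable]: "?g \<in> borel_measurable borel" by measurable
  have "(LINT y:{y :: real \<times> real. (norm y)\<^sup>2 < R}|lborel. d / (c - of_real ((norm y)\<^sup>2))\<^sup>2)
      = (LINT y|(lborel :: (real \<times> real) measure). indicator {-R<..} (- (norm y)\<^sup>2) *\<^sub>R ?g (- (norm y)\<^sup>2))"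
    unfolding set_lebesgue_integral_def
    by (rule Bochner_Integration.integral_cong) (auto simp: indicator_def)
  also have "\<dots> = (LINT w|distr lborel borel (\<lambda>y::real \<times> real. - (norm y)\<^sup>2). indicator {-R<..} w *\<^sub>R ?g w)"
    by (rule integral_distr[symmetric]) auto
  also have "\<dots> = (LINT w|lborel. (pi * indicator {..0} w) *\<^sub>R (indicator {-R<..} w *\<^sub>R ?g w))"
    unfolding distr_neg_norm_sq_plane by (rule integral_density) auto
  also have "\<dots> = (LINT w|lborel. pi *\<^sub>R (indicator {-R<..0} w *\<^sub>R ?g w))"
    by (rule Bochner_Integration.integral_cong) (auto simp: indicator_def)
  also have "\<dots> = pi *\<^sub>R (LINT w|lborel. indicator {-R<..0} w *\<^sub>R ?g w)"
    by (simp del: scaleR_scaleR)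
  \<comment> \<open>The left endpoint is a null set.\<close>
  also have "(LINT w|lborel. indicator {-R<..0} w *\<^sub>R ?g w) = (LINT w|lborel. indicator {-R..0} w *\<^sub>R ?g w)"
    by (rule integral_cong_AE) (auto intro!: AE_I[where N="{-R}"] simp: indicator_def)
  also have "\<dots> = - d / (c + of_real 0) - - d / (c + of_real (-R))"
  proof (rule integral_FTC_atLeastAtMost)
    show "-R \<le> 0" using assms by simp
    show "((\<lambda>w. - d / (c + of_real w)) has_vector_derivative ?g x) (at x within {-R..0})" for x
      unfolding has_vector_derivative_def
      apply (rule derivative_eq_intros refl nz)+
      using nz[of x] by (auto simp: field_simps power2_eq_square scaleR_conv_of_real)
    show "continuous_on {-R..0} ?g"
      using nz by (auto intro!: continuous_intros)
  qed
  finally show ?thesis by (simp add: scaleR_conv_of_real)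
qed

text \<open>The height is put first so that Fubini integrates over horizontal planes inside.\<close>

definition vec3 :: "real \<times> real \<times> real \<Rightarrow> real^3"
  where "vec3 = (\<lambda>(z, a, b). vector [a, b, z])"

lemma vec3_nth [simp]: "vec3 (z, y) $ 3 = z" "vec3 (z, y) $ 1 = fst y" "vec3 (z, y) $ 2 = snd y"
  by (auto simp: vec3_def split: prod.split)

lemma norm_vec3_sq: "(norm (vec3 (z, y)))\<^sup>2 = z\<^sup>2 + (norm y)\<^sup>2"
  by (cases y) (simp add: norm_vec_def L2_set_def sum_3 vec3_def norm_Pair)

lemma measurable_vec3 [measurable]: "vec3 \<in> borel_measurable borel"
proof -
  have "continuous_on UNIV vec3"
    by (subst continuous_on_componentwise) 
       (auto simp: Basis_vec_def inner_axis vec3_def split_beta forall_3 intro!: continuous_intros)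
  then show ?thesis by (rule borel_measurable_continuous_onI)
qed

lemma lborel_vec3: "lborel = distr lborel borel vec3"
proof (rule lborel_eqI)
  fix l u :: "real^3"
  assume le: "\<And>b. b \<in> Basis \<Longrightarrow> l \<bullet> b \<le> u \<bullet> b"
  have le': "l $ i \<le> u $ i" for i
    using le[of "axis i 1"] by (auto simp: inner_axis)
  have "emeasure (distr lborel borel vec3) (box l u) = emeasure lborel (vec3 -` box l u \<inter> space lborel)"
    by (rule emeasure_distr) auto
  also have "vec3 -` box l u \<inter> space lborel = box (l$3, l$1, l$2) (u$3, u$1, u$2)"
    by (auto simp: mem_box_cart forall_3 box_prod)
  also have "emeasure lborel \<dots> = ennreal ((u$3 - l$3) * ((u$1 - l$1) * (u$2 - l$2)))"
    apply (subst emeasure_lborel_box)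
    using le' by (auto simp: Basis_prod_def inner_Pair prod.union_disjoint)
  also have "\<dots> = ennreal (\<Prod>b\<in>Basis. (u - l) \<bullet> b)"
  proof -
    have *: "(Basis :: (real^3) set) = (\<lambda>i. axis i 1) ` UNIV"
      by (auto simp: Basis_vec_def)
    have "inj (\<lambda>i::3. axis i (1::real))"
      by (auto simp: inj_on_def axis_eq_axis)
    then have "(\<Prod>b\<in>Basis. (u - l) \<bullet> b) = (\<Prod>i\<in>UNIV. (u - l) \<bullet> axis i 1)"
      unfolding * by (subst prod.reindex) (auto simp: o_def)
    also have "\<dots> = (\<Prod>i\<in>{1, 2, 3}. u $ i - l $ i)"
      by (simp only: UNIV_3 inner_axis) simp
    also have "\<dots> = (u$3 - l$3) * ((u$1 - l$1) * (u$2 - l$2))"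
      by simp
    finally show ?thesis by simp
  qed
  finally show "emeasure (distr lborel borel vec3) (box l u) = (\<Prod>b\<in>Basis. (u - l) \<bullet> b)" .
qed simp

lemma integral_vec3:
  fixes g :: "real^3 \<Rightarrow> complex"
  assumes "integrable lborel g"
  shows "integrable lborel (\<lambda>z. LINT y|lborel. g (vec3 (z, y)))"
    and "(LINT x|lborel. g x) = (LINT z|lborel. LINT y|lborel. g (vec3 (z, y)))"
proof -
  have [measurable]: "g \<in> borel_measurable borel" using assms by auto
  have "integrable (distr lborel borel vec3) g" using assms by (simp flip: lborel_vec3)
  then have "integrable lborel (\<lambda>p. g (vec3 p))" by (subst (asm) integrable_distr_eq) auto
  then have I: "integrable (lborel \<Otimes>\<^sub>M lborel) (\<lambda>(z, y). g (vec3 (z, y)))"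
    by (simp add: lborel_prod split_beta')
  show "integrable lborel (\<lambda>z. LINT y|lborel. g (vec3 (z, y)))"
    using lborel_pair.integrable_fst[OF I] by simp
  have "(LINT x|lborel. g x) = (LINT x|distr lborel borel vec3. g x)" by (simp flip: lborel_vec3)
  also have "\<dots> = (LINT p|lborel. g (vec3 p))" by (rule integral_distr) auto
  also have "\<dots> = integral\<^sup>L (lborel \<Otimes>\<^sub>M lborel) (\<lambda>(z, y). g (vec3 (z, y)))"
    by (simp add: lborel_prod split_beta')
  also have "\<dots> = (LINT z|lborel. LINT y|lborel. g (vec3 (z, y)))"
    using lborel_pair.integral_fst[OF I] by simp
  finally show "(LINT x|lborel. g x) = (LINT z|lborel. LINT y|lborel. g (vec3 (z, y)))" .
qed

section \<open>The logarithmic profile\<close>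

text \<open>The quotient \<open>profile u / u\<close>, with modulus of continuity \<open>1 / \<bar>ln u\<bar>\<close> at \<open>0\<close>: it tends to \<open>0\<close>,
  but \<open>slope u / u\<close> is not integrable near \<open>0\<close>.\<close>

definition slope :: "real \<Rightarrow> real"
  where "slope u = (if u \<le> 0 then 0 else 1 / (1 - ln u))"

definition profile :: "real \<Rightarrow> real"
  where "profile u = u * slope u"

lemma slope_bounds:
  assumes "u \<le> 1"
  shows "0 \<le> slope u" "slope u \<le> 1" "0 < u \<Longrightarrow> 0 < slope u"
proof -
  have "ln u < 1" "ln u \<le> 0" if "0 < u" using assms that ln_le_zero_iff[of u] by linarith+
  then show "0 \<le> slope u" "slope u \<le> 1" "0 < u \<Longrightarrow> 0 < slope u"
    by (auto simp: slope_def not_le divide_le_eq_1 less_imp_le)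
qed

lemma slope_mono:
  assumes "u \<le> v" "v \<le> 1"
  shows "slope u \<le> slope v"
proof (cases "u \<le> 0")
  case True
  then show ?thesis using slope_bounds[OF assms(2)] by (simp add: slope_def)
next
  case False
  then have "ln u \<le> ln v" "ln u < 1" "ln v < 1"
    using assms ln_le_zero_iff[of u] ln_le_zero_iff[of v] ln_le_cancel_iff[of u v] by linarith+
  then show ?thesis using False assms by (auto simp: slope_def intro!: divide_left_mono mult_pos_pos)
qed

lemma isCont_slope:
  assumes "u \<le> 1"
  shows "isCont slope u"
proof -
  consider "u < 0" | "u = 0" | "0 < u" by linarith
  then show ?thesis
  proof cases
    case 1
    have "\<forall>\<^sub>F v in nhds u. slope v = 0"
      using eventually_nhds_in_open[of "{..<0}" u] 1
      by (auto simp: slope_def elim!: eventually_mono)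
    then show ?thesis by (simp add: isCont_cong)
  next
    case 3
    have "ln u \<noteq> 1" using 3 assms ln_le_zero_iff[of u] by linarith
    then have "isCont (\<lambda>v. 1 / (1 - ln v)) u"
      using 3 by (auto intro!: continuous_intros)
    moreover have "\<forall>\<^sub>F v in nhds u. slope v = 1 / (1 - ln v)"
      using eventually_nhds_in_open[of "{0<..}" u] 3
      by (auto simp: slope_def elim!: eventually_mono)
    ultimately show ?thesis by (simp add: isCont_cong)
  next
    case 2
    have "filterlim (\<lambda>v::real. 1 + - ln v) at_top (at_right 0)"
      by (intro filterlim_tendsto_add_at_top[OF tendsto_const]
          filterlim_compose[OF filterlim_uminus_at_top_at_bot] ln_at_0)
    then have "((\<lambda>v::real. inverse (1 + - ln v)) \<longlongrightarrow> 0) (at_right 0)"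
      by (rule tendsto_inverse_0_at_top)
    moreover have "\<forall>\<^sub>F v in at_right 0. inverse (1 + - ln v) = slope v"
      using eventually_at_right_less[of 0]
      by (auto simp: slope_def divide_inverse elim!: eventually_mono)
    ultimately have "(slope \<longlongrightarrow> 0) (at_right 0)"
      by (rule Lim_transform_eventually)
    moreover have "(slope \<longlongrightarrow> 0) (at_left 0)"
    proof (rule Lim_transform_eventually[OF tendsto_const])
      show "\<forall>\<^sub>F v in at_left 0. 0 = slope v"
        using eventually_at_left_real[of "-1" 0]
        by (auto simp: slope_def elim!: eventually_mono)
    qed
    ultimately have "(slope \<longlongrightarrow> 0) (at 0)"
      by (simp add: filterlim_at_split)
    then show ?thesis by (simp add: 2 isCont_def slope_def)
  qed
qed

text \<open>On the positive side the derivative of \<open>slope\<close> is \<open>(slope u)\<^sup>2 / u\<close>. So the derivative of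
  \<open>profile\<close> is a polynomial in the continuous function \<open>slope\<close>, which gives \<open>C\<^sup>1\<close> across \<open>0\<close>.\<close>

lemma profile_has_derivative:
  assumes "u \<le> 1"
  shows "(profile has_real_derivative (slope u + (slope u)\<^sup>2)) (at u)"
proof (cases "u \<le> 0")
  case True
  show ?thesis
  proof (cases "u = 0")
    case True
    have "\<forall>v. profile v - profile 0 = slope v * (v - 0)" "isCont slope 0" "slope 0 = 0"
      using isCont_slope[of 0] by (auto simp: profile_def slope_def)
    then show ?thesis unfolding True CARAT_DERIV by auto
  next
    case False
    have "\<forall>\<^sub>F v in nhds u. profile v = 0"
      using eventually_nhds_in_open[of "{..<0}" u] False True
      by (auto simp: profile_def slope_def elim!: eventually_mono)
    then show ?thesis using True by (simp add: DERIV_cong_ev slope_def)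
  qed
next
  case False
  have "1 - ln u \<noteq> 0" using False assms ln_le_zero_iff[of u] by linarith
  then have "((\<lambda>v. v * (1 / (1 - ln v))) has_real_derivative (slope u + (slope u)\<^sup>2)) (at u)"
    using False
    by (auto intro!: derivative_eq_intros simp: slope_def power_one_over divide_inverse power2_eq_square)
  moreover have "\<forall>\<^sub>F v in nhds u. profile v = v * (1 / (1 - ln v))"
    using eventually_nhds_in_open[of "{0<..}" u] False
    by (auto simp: profile_def slope_def elim!: eventually_mono)
  ultimately show ?thesis by (simp add: DERIV_cong_ev)
qed

lemma profile_strict_mono:
  assumes "0 \<le> u" "u < v" "v \<le> 1"
  shows "profile u < profile v"
  unfolding profile_def
proof -
  have "u * slope u \<le> u * slope v"
    using assms slope_mono[of u v] by (intro mult_left_mono) auto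
  also have "\<dots> < v * slope v"
    using assms slope_bounds(3)[of v] by simp
  finally show "u * slope u < v * slope v" .
qed

lemma profile_nonneg: "u \<le> 1 \<Longrightarrow> 0 \<le> profile u"
  using slope_bounds[of u] by (cases "u \<le> 0") (auto simp: profile_def slope_def)

lemma profile_one: "profile 1 = 1"
  by (simp add: profile_def slope_def)

text \<open>The number \<open>h\<close> is the inverse of \<open>profile\<close> at \<open>z\<close>, truncated at \<open>1\<close>. Since \<open>z \<le> h\<close>, the
  equation \<open>h = z (1 - ln h)\<close> gives the upper bound \<open>z (1 - ln z)\<close>, whose reciprocal is not
  integrable near \<open>0\<close>.\<close>

lemma profile_sublevel:
  assumes "0 < z"
  obtains h where "0 < h" "z < 1 \<Longrightarrow> z \<le> h" "z < 1 \<Longrightarrow> h \<le> z * (1 - ln z)" "1 \<le> z \<Longrightarrow> h = 1"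
    "\<And>u. (u < 1 \<and> profile u < z) \<longleftrightarrow> u < h"
proof (cases "z < 1")
  case True
  have "\<exists>h\<ge>0. h \<le> 1 \<and> profile h = z"
  proof (rule IVT)
    show "profile 0 \<le> z" "z \<le> profile 1" "0 \<le> (1::real)"
      using assms True by (auto simp: profile_one) (simp add: profile_def)
    show "\<forall>x. 0 \<le> x \<and> x \<le> 1 \<longrightarrow> isCont profile x"
      using profile_has_derivative DERIV_isCont by blast
  qed
  then obtain h where h: "0 \<le> h" "h \<le> 1" "profile h = z" by auto
  have "h \<noteq> 0" using h assms by (auto simp: profile_def)
  then have "0 < h" using h by simp
  have lnh: "1 - ln h \<noteq> 0" using h \<open>0 < h\<close> ln_le_zero_iff[of h] by linarith
  have h_eq: "h = z * (1 - ln h)"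
    using h lnh \<open>0 < h\<close> by (auto simp: profile_def slope_def)
  have "z \<le> h" using h \<open>0 < h\<close> slope_bounds[of h] mult_left_le[of "slope h" h]
    by (auto simp: profile_def)
  then have "ln z \<le> ln h" using assms \<open>0 < h\<close> by simp
  then have "z * (1 - ln h) \<le> z * (1 - ln z)" using assms by simp
  then have "h \<le> z * (1 - ln z)" using h_eq by simp
  moreover have "(u < 1 \<and> profile u < z) \<longleftrightarrow> u < h" for u
  proof (cases "u \<le> 0")
    case True
    then show ?thesis using assms \<open>0 < h\<close> by (auto simp: profile_def slope_def)
  next
    case False
    have "h \<noteq> 1" using h True by (auto simp: profile_one)
    then show ?thesis using h False profile_strict_mono[of u h] profile_strict_mono[of h u]
        by (cases u h rule: linorder_cases) auto
  qed
  ultimately show ?thesis using that \<open>0 < h\<close> h \<open>z \<le> h\<close> True by auto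
next
  case False
  have "profile u < z" if "u < 1" for u
    using False that profile_strict_mono[of u 1] assms 
    by (cases "u \<le> 0") (auto simp: profile_one profile_def[of u] slope_def)
  then show ?thesis using that[of 1] False by auto
qed

section \<open>The region and its boundary\<close>

definition log_region :: "K3 set"
  where "log_region = {x. (norm x)\<^sup>2 < 2 \<and> profile ((norm x)\<^sup>2 - 1) < x $ 3}"

definition region_fun :: "K3 \<Rightarrow> real"
  where "region_fun x = profile ((norm x)\<^sup>2 - 1) - x $ 3"

definition region_gradient :: "K3 \<Rightarrow> K3"
  where "region_gradient x =
    (2 * (slope ((norm x)\<^sup>2 - 1) + (slope ((norm x)\<^sup>2 - 1))\<^sup>2)) *\<^sub>R x - axis 3 1"

lemma region_fun_has_derivative:
  assumes "(norm x)\<^sup>2 \<le> 2"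
  shows "(region_fun has_derivative (\<lambda>v. region_gradient x \<bullet> v)) (at x)"
proof -
  let ?u = "\<lambda>x::K3. x \<bullet> x - 1"
  have u: "(?u has_derivative (\<lambda>v. 2 * (x \<bullet> v))) (at x)"
    by (auto intro!: derivative_eq_intros simp: inner_commute)
  have "(profile has_derivative (*) (slope (?u x) + (slope (?u x))\<^sup>2)) (at (?u x))"
    using profile_has_derivative[of "?u x"] assms
    by (simp add: has_field_derivative_def power2_norm_eq_inner)
  from diff_chain_at[OF u this]
  have "((\<lambda>x. profile (?u x)) has_derivative
      (\<lambda>v. (slope (?u x) + (slope (?u x))\<^sup>2) * (2 * (x \<bullet> v)))) (at x)"
    by (simp add: o_def)
  moreover have "((\<lambda>x::K3. x $ 3) has_derivative (\<lambda>v. v $ 3)) (at x)"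
    by (intro bounded_linear_imp_has_derivative bounded_linear_vec_nth)
  ultimately have "((\<lambda>x. profile (?u x) - x $ 3) has_derivative
      (\<lambda>v. (slope (?u x) + (slope (?u x))\<^sup>2) * (2 * (x \<bullet> v)) - v $ 3)) (at x)"
    by (rule has_derivative_diff)
  moreover have "axis 3 1 \<bullet> v = v $ 3" for v :: K3
    by (simp add: inner_axis')
  then have "(\<lambda>v. (slope (?u x) + (slope (?u x))\<^sup>2) * (2 * (x \<bullet> v)) - v $ 3) =
      (\<lambda>v. region_gradient x \<bullet> v)"
    by (simp add: region_gradient_def inner_diff_left power2_norm_eq_inner fun_eq_iff)
  moreover have "(\<lambda>x. profile (?u x) - x $ 3) = region_fun"
    by (simp add: region_fun_def fun_eq_iff power2_norm_eq_inner)
  ultimately show ?thesis by simp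
qed

lemma isCont_region_fun: "(norm x)\<^sup>2 \<le> 2 \<Longrightarrow> isCont region_fun x"
  using region_fun_has_derivative has_derivative_continuous by blast

lemma open_ball_sqrt2: "open {x::K3. (norm x)\<^sup>2 < 2}"
  by (intro open_Collect_less continuous_intros)

lemma log_region_alt: "log_region = {x. (norm x)\<^sup>2 < 2} \<inter> region_fun -` {..<0}"
  by (auto simp: log_region_def region_fun_def)

lemma open_log_region: "open log_region"
  unfolding log_region_alt
  by (rule continuous_open_preimage)
     (auto intro!: open_ball_sqrt2 continuous_at_imp_continuous_on isCont_region_fun)

lemma C1_on_region_fun: "C1_on {x. (norm x)\<^sup>2 < 2} region_fun"
  unfolding C1_on_def
proof (intro exI[of _ "\<lambda>x. blinfun_inner_right (region_gradient x)"] conjI ballI)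
  show "(region_fun has_derivative blinfun_apply (blinfun_inner_right (region_gradient x))) (at x)"
    if "x \<in> {x. (norm x)\<^sup>2 < 2}" for x
    using region_fun_has_derivative[of x] that by simp
  have "isCont (\<lambda>x. slope ((norm x)\<^sup>2 - 1)) x" if "(norm x)\<^sup>2 < 2" for x :: K3
    using that by (intro isCont_o2[OF _ isCont_slope] continuous_intros) auto
  then have "continuous_on {x::K3. (norm x)\<^sup>2 < 2} (\<lambda>x. slope ((norm x)\<^sup>2 - 1))"
    by (intro continuous_at_imp_continuous_on) auto
  then have "continuous_on {x. (norm x)\<^sup>2 < 2} region_gradient"
    unfolding region_gradient_def by (intro continuous_intros)
  then show "continuous_on {x. (norm x)\<^sup>2 < 2} (\<lambda>x. blinfun_inner_right (region_gradient x))"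
    by (rule bounded_linear.continuous_on[OF bounded_linear_blinfun_inner_right])
qed

text \<open>A vanishing gradient would make \<open>x\<close> vertical with \<open>2 (m + m\<^sup>2) \<bar>x\<bar>\<^sup>2 = x $ 3\<close>, where \<open>m \<ge> 0\<close> is the
  slope; but on the surface \<open>x $ 3 = (\<bar>x\<bar>\<^sup>2 - 1) m\<close>. This forces \<open>m = 0\<close>, and then
  the gradient is \<open>- axis 3 1\<close>.\<close>

lemma region_gradient_nonzero:
  assumes "(norm x)\<^sup>2 < 2" "region_fun x = 0"
  shows "region_gradient x \<noteq> 0"
proof
  assume 0: "region_gradient x = 0"
  let ?u = "(norm x)\<^sup>2 - 1"
  let ?m = "slope ?u"
  have m: "0 \<le> ?m" using slope_bounds[of ?u] assms by simp
  have "region_gradient x \<bullet> axis 3 1 = 0" using 0 by simp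
  then have *: "2 * (?m + ?m\<^sup>2) * x $ 3 = 1"
    by (simp add: region_gradient_def inner_diff_left inner_axis)
  have "region_gradient x \<bullet> x = 0" using 0 by simp
  then have "2 * (?m + ?m\<^sup>2) * (norm x)\<^sup>2 = x $ 3"
    unfolding region_gradient_def inner_diff_left
    by (simp add: inner_axis' power2_norm_eq_inner)
  also have "x $ 3 = ?u * ?m" using assms by (simp add: region_fun_def profile_def)
  also have "\<dots> \<le> ?m * (norm x)\<^sup>2" using m by (simp add: algebra_simps)
  finally have "(?m + 2 * ?m\<^sup>2) * (norm x)\<^sup>2 \<le> 0" by (simp add: algebra_simps)
  moreover have "x \<noteq> 0" using * by auto
  ultimately have "?m + 2 * ?m\<^sup>2 \<le> 0" by (simp add: mult_le_0_iff)
  then have "?m = 0" using m zero_le_power2[of ?m] by linarith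
  then show False using * by simp
qed

text \<open>From a regular zero one enters the open sublevel set by moving against the gradient.\<close>

lemma regular_zero_in_closure_sublevel:
  fixes F :: "'a::real_inner \<Rightarrow> real"
  assumes F: "(F has_derivative (\<lambda>v. g \<bullet> v)) (at x)" and "F x = 0" "g \<noteq> 0" "open V" "x \<in> V"
  shows "x \<in> closure (V \<inter> F -` {..<0})"
proof -
  define c where "c t = x + t *\<^sub>R (- g)" for t :: real
  have "(c has_derivative (\<lambda>t. t *\<^sub>R (- g))) (at 0)"
    unfolding c_def by (auto intro!: derivative_eq_intros)
  then have "((F \<circ> c) has_derivative ((\<lambda>v. g \<bullet> v) \<circ> (\<lambda>t. t *\<^sub>R (- g)))) (at 0)"
    by (rule diff_chain_at) (use F in \<open>simp add: c_def\<close>)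
  then have "((F \<circ> c) has_real_derivative - (g \<bullet> g)) (at 0)"
    unfolding has_field_derivative_def
    by (rule has_derivative_eq_rhs) (auto simp: fun_eq_iff)
  moreover have "- (g \<bullet> g) < 0" using \<open>g \<noteq> 0\<close> by simp
  ultimately obtain d where "d > 0" and d: "\<And>t. 0 < t \<Longrightarrow> t < d \<Longrightarrow> (F \<circ> c) (0 + t) < (F \<circ> c) 0"
    using DERIV_neg_dec_right[of "F \<circ> c" "- (g \<bullet> g)" 0] by auto
  have lim: "(c \<longlongrightarrow> x) (at_right 0)"
    unfolding c_def by (auto intro!: tendsto_eq_intros)
  then have "\<forall>\<^sub>F t in at_right 0. c t \<in> V"
    using assms topological_tendstoD by blast
  moreover have "\<forall>\<^sub>F t in at_right 0. F (c t) < 0"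
    using eventually_at_right_real[OF \<open>d > 0\<close>]
    by eventually_elim (use d \<open>F x = 0\<close> in \<open>auto simp: c_def\<close>)
  ultimately have "\<forall>\<^sub>F t in at_right 0. c t \<in> V \<inter> F -` {..<0}"
    by eventually_elim simp
  then have "\<forall>\<^sub>F t in at_right 0. c t \<in> closure (V \<inter> F -` {..<0})"
    by (rule eventually_mono) (rule subsetD[OF closure_subset])
  then show ?thesis
    by (rule Lim_in_closed_set[OF closed_closure _ _ lim]) simp
qed

lemma frontier_log_region:
  "frontier log_region \<inter> {x. (norm x)\<^sup>2 < 2} = {x \<in> {x. (norm x)\<^sup>2 < 2}. region_fun x = 0}"
proof (intro equalityI subsetI)
  fix x assume x: "x \<in> frontier log_region \<inter> {x. (norm x)\<^sup>2 < 2}"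
  then have "x \<notin> log_region" using open_log_region by (auto simp: frontier_def interior_open)
  then have "\<not> region_fun x < 0" using x by (auto simp: log_region_alt)
  moreover have "\<not> region_fun x > 0"
  proof
    assume "region_fun x > 0"
    have "open ({x. (norm x)\<^sup>2 < 2} \<inter> region_fun -` {0<..})"
      by (rule continuous_open_preimage)
         (auto intro!: open_ball_sqrt2 continuous_at_imp_continuous_on isCont_region_fun)
    moreover have "x \<in> closure log_region" using x by (simp add: frontier_def)
    ultimately have "({x. (norm x)\<^sup>2 < 2} \<inter> region_fun -` {0<..}) \<inter> log_region \<noteq> {}"
      using \<open>region_fun x > 0\<close> x by (subst open_Int_closure_eq_empty[symmetric]) auto
    then show False by (auto simp: log_region_alt)
  qed
  ultimately show "x \<in> {x \<in> {x. (norm x)\<^sup>2 < 2}. region_fun x = 0}" using x by auto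
next
  fix x assume x: "x \<in> {x \<in> {x. (norm x)\<^sup>2 < 2}. region_fun x = 0}"
  then have "x \<in> closure log_region"
    unfolding log_region_alt
    by (intro regular_zero_in_closure_sublevel[OF region_fun_has_derivative]
        region_gradient_nonzero open_ball_sqrt2) auto
  moreover have "x \<notin> log_region" using x by (auto simp: log_region_alt)
  ultimately show "x \<in> frontier log_region \<inter> {x. (norm x)\<^sup>2 < 2}"
    using x open_log_region by (auto simp: frontier_def interior_open)
qed

text \<open>The single equation \<open>region_fun = 0\<close> serves at all points of the sphere. The surface meets the
  sphere along the equator, where its tangent plane is horizontal because \<open>slope\<close> vanishes at \<open>0\<close>,
  while the tangent plane of the sphere contains the vertical direction.\<close>

lemma C1_transversal_log_region: "C1_transversal log_region"
  unfolding C1_transversal_def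
proof (intro ballI exI[of _ "{x. (norm x)\<^sup>2 < 2}"] exI[of _ region_fun] conjI)
  let ?V = "{x::K3. (norm x)\<^sup>2 < 2}"
  fix p assume p: "p \<in> frontier log_region \<inter> boundary_H3"
  show "open ?V" by (rule open_ball_sqrt2)
  show "p \<in> ?V" using p by (simp add: boundary_H3_def)
  have fd: "frechet_derivative region_fun (at x) = (\<lambda>v. region_gradient x \<bullet> v)" if "x \<in> ?V" for x
    using frechet_derivative_at[OF region_fun_has_derivative[of x]] that by simp
  have "(\<lambda>v. region_gradient x \<bullet> v) \<noteq> (\<lambda>v. 0)" if "x \<in> ?V" "region_fun x = 0" for x
    using region_gradient_nonzero[of x] that by (auto simp: fun_eq_iff)
  then show "regular_C1_equation (frontier log_region) ?V region_fun"
    unfolding regular_C1_equation_def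
    using C1_on_region_fun frontier_log_region fd by simp
  fix q assume q: "q \<in> frontier log_region \<inter> ?V \<inter> boundary_H3"
  then have nq: "norm q = 1" by (simp add: boundary_H3_def)
  have "q \<in> {x \<in> ?V. region_fun x = 0}" using q frontier_log_region by blast
  then have "region_fun q = 0" by simp
  then have q3: "q $ 3 = 0" using nq by (simp add: region_fun_def profile_def)
  have "region_gradient q = - axis 3 1"
    using nq by (simp add: region_gradient_def slope_def)
  then have 1: "v \<in> tangent_plane region_fun q \<longleftrightarrow> v $ 3 = 0" for v
    using fd[of q] q by (simp add: tangent_plane_def inner_axis' )
  have "((\<lambda>x::K3. (norm x)\<^sup>2 - 1) has_derivative (\<lambda>v. 2 * (q \<bullet> v))) (at q)"
    unfolding power2_norm_eq_inner
    by (auto intro!: derivative_eq_intros simp: inner_commute)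
  from frechet_derivative_at[OF this]
  have 2: "v \<in> tangent_plane (\<lambda>x. (norm x)\<^sup>2 - 1) q \<longleftrightarrow> q \<bullet> v = 0" for v
    by (simp add: tangent_plane_def flip: fun_eq_iff) (metis mult_eq_0_iff zero_neq_numeral)
  have "w \<in> {u + v | u v. u \<in> tangent_plane region_fun q \<and>
      v \<in> tangent_plane (\<lambda>x. (norm x)\<^sup>2 - 1) q}" for w
  proof -
    have "w - axis 3 (w $ 3) \<in> tangent_plane region_fun q" unfolding 1 by simp
    moreover have "axis 3 (w $ 3) \<in> tangent_plane (\<lambda>x. (norm x)\<^sup>2 - 1) q"
      unfolding 2 using q3 by (simp add: inner_axis)
    moreover have "w = (w - axis 3 (w $ 3)) + axis 3 (w $ 3)" by simp
    ultimately show ?thesis by blast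
  qed
  then show "{u + v | u v. u \<in> tangent_plane region_fun q \<and>
      v \<in> tangent_plane (\<lambda>x. (norm x)\<^sup>2 - 1) q} = UNIV"
    by blast
qed

text \<open>Star-shapedness about the origin (which is a boundary point): under scaling of \<open>x\<close> by \<open>t\<close>,
  the height scales by \<open>t\<close> and the excess \<open>\<bar>x\<bar>\<^sup>2 - 1\<close>, where positive, drops at least by
  the factor \<open>t\<close>.\<close>

lemma scaled_mem_log_region:
  assumes x: "x \<in> log_region" and t: "0 < t" "t \<le> 1"
  shows "t *\<^sub>R x \<in> log_region"
proof -
  let ?s = "(norm x)\<^sup>2"
  have s: "?s < 2" and x3: "profile (?s - 1) < x $ 3" using x by (auto simp: log_region_def)
  have "0 \<le> profile (?s - 1)" using s by (intro profile_nonneg) simp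
  then have x3pos: "0 < x $ 3" using x3 by linarith
  have t2: "t\<^sup>2 \<le> t" "t\<^sup>2 \<le> 1" using t by (auto simp: power2_eq_square mult_le_one)
  have ts: "t\<^sup>2 * ?s \<le> ?s" using t2 by (simp add: mult_left_le_one_le)
  have "profile (t\<^sup>2 * ?s - 1) < t * x $ 3"
  proof (cases "t\<^sup>2 * ?s \<le> 1")
    case True
    then show ?thesis using x3pos t by (simp add: profile_def slope_def)
  next
    case False
    then have s1: "1 < ?s" using ts by linarith
    have "t\<^sup>2 * ?s - 1 \<le> t\<^sup>2 * (?s - 1)" using t2 by (simp add: algebra_simps)
    also have "\<dots> \<le> t * (?s - 1)" using t2 s1 by (intro mult_right_mono) auto
    finally have "profile (t\<^sup>2 * ?s - 1) \<le> t * (?s - 1) * slope (?s - 1)"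
      unfolding profile_def using False s s1 ts t
      by (intro mult_mono slope_mono slope_bounds) auto
    also have "\<dots> = t * profile (?s - 1)" by (simp add: profile_def)
    also have "\<dots> < t * x $ 3" using x3 t by simp
    finally show ?thesis .
  qed
  moreover have "t\<^sup>2 * ?s < 2" using ts s by linarith
  ultimately show ?thesis using t by (simp add: log_region_def power_mult_distrib)
qed

text \<open>The segment from \<open>x\<close> to \<open>x / 2\<close> joins each point to the convex upper half of the unit ball.\<close>

lemma connected_log_region: "connected log_region"
proof -
  define B :: "K3 set" where "B = ball 0 1 \<inter> {x. axis 3 1 \<bullet> x > 0}"
  have B: "x \<in> B \<longleftrightarrow> norm x < 1 \<and> 0 < x $ 3" for x
    by (simp add: B_def inner_axis')
  have "convex B" unfolding B_def by (intro convex_Int convex_ball convex_halfspace_gt)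
  have half: "(1/2) *\<^sub>R x \<in> B" if "x \<in> log_region" for x
  proof -
    have s: "(norm x)\<^sup>2 < 2" "profile ((norm x)\<^sup>2 - 1) < x $ 3"
      using that by (auto simp: log_region_def)
    have "0 \<le> profile ((norm x)\<^sup>2 - 1)" using s by (intro profile_nonneg) simp
    then have "0 < x $ 3" using s by linarith
    moreover have "norm x < 2" by (rule power2_less_imp_less) (use s(1) in auto)
    ultimately show ?thesis by (simp add: B)
  qed
  have B_sub: "B \<subseteq> log_region"
  proof
    fix x assume "x \<in> B"
    then have x: "norm x < 1" "0 < x $ 3" by (auto simp: B)
    then have "(norm x)\<^sup>2 < 1" by (simp add: power_less_one_iff)
    then show "x \<in> log_region" using x by (auto simp: log_region_def profile_def slope_def)
  qed
  define C where "C x = B \<union> closed_segment ((1/2) *\<^sub>R x) x" for x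
  have C_sub: "C x \<subseteq> log_region" if x: "x \<in> log_region" for x
  proof -
    have "(1 - u) *\<^sub>R ((1/2) *\<^sub>R x) + u *\<^sub>R x \<in> log_region" if "0 \<le> u" "u \<le> 1" for u
    proof -
      have "(1 - u) *\<^sub>R ((1/2) *\<^sub>R x) + u *\<^sub>R x = ((1 + u) / 2) *\<^sub>R x"
        unfolding scaleR_scaleR scaleR_add_left[symmetric] by (simp add: field_simps)
      then show ?thesis using scaled_mem_log_region[OF x, of "(1 + u) / 2"] that by simp
    qed
    then show ?thesis using B_sub by (auto simp: C_def in_segment)
  qed
  have "connected (C x)" if "x \<in> log_region" for x
    unfolding C_def using half[OF that] \<open>convex B\<close>
    by (intro connected_Un convex_connected convex_closed_segment) auto
  moreover have "(1/4) *\<^sub>R axis 3 1 \<in> B" by (simp add: B)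
  ultimately have "connected (\<Union> (C ` log_region))"
    by (intro connected_Union) (auto simp: C_def)
  moreover have "\<Union> (C ` log_region) = log_region"
    using C_sub by (auto simp: C_def)
  ultimately show ?thesis by simp
qed

lemma domain_log_region: "domain_K3 log_region"
proof -
  have "(1/2) *\<^sub>R axis 3 1 \<in> log_region"
    by (simp add: log_region_def profile_def slope_def power2_eq_square)
  then show ?thesis
    unfolding domain_K3_def using open_log_region connected_log_region by blast
qed

section \<open>Divergence of the volume\<close>

lemma d_eps_sq_minus: "(d_eps e)\<^sup>2 - of_real s = Complex (1 - e\<^sup>2 - s) (- 2 * e)"
  by (simp add: d_eps_def complex_eq_iff power2_eq_square)

lemma dV_integrable:
  assumes "e > 0"
  shows "integrable lborel (\<lambda>x. indicator log_region x *\<^sub>R dV_density e x)"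
proof -
  have "(d_eps e)\<^sup>2 - of_real s \<noteq> 0" for s
    unfolding d_eps_sq_minus using assms by (simp add: complex_eq_iff)
  then have "continuous_on (cball 0 (sqrt 2)) (dV_density e)"
    unfolding dV_density_def by (intro continuous_intros) (auto simp del: of_real_power)
  then have "set_integrable lborel (cball 0 (sqrt 2)) (dV_density e)"
    unfolding set_integrable_def by (intro borel_integrable_compact) auto
  then have "set_integrable lborel log_region (dV_density e)"
  proof (rule set_integrable_subset)
    show "log_region \<in> sets lborel" using open_log_region by simp
    show "log_region \<subseteq> cball 0 (sqrt 2)"
      by (auto simp: log_region_def intro!: less_imp_le[OF real_less_rsqrt])
  qed
  then show ?thesis by (simp add: set_integrable_def)
qed

definition slice_integral :: "real \<Rightarrow> real \<Rightarrow> complex"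
  where "slice_integral e z =
    (LINT y|lborel. indicator log_region (vec3 (z, y)) *\<^sub>R dV_density e (vec3 (z, y)))"

lemma slice_integral_outside:
  assumes "z \<notin> {0<..<sqrt 2}"
  shows "slice_integral e z = 0"
proof -
  have "vec3 (z, y) \<notin> log_region" for y
  proof
    assume "vec3 (z, y) \<in> log_region"
    then have *: "z\<^sup>2 + (norm y)\<^sup>2 < 2" "profile (z\<^sup>2 + (norm y)\<^sup>2 - 1) < z"
      by (auto simp: log_region_def norm_vec3_sq)
    have "0 \<le> profile (z\<^sup>2 + (norm y)\<^sup>2 - 1)" using * by (intro profile_nonneg) simp
    then have "0 < z" using * by linarith
    moreover have "z\<^sup>2 < 2" using * zero_le_power2[of "norm y"] by linarith
    then have "z < sqrt 2" by (rule real_less_rsqrt)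
    ultimately show False using assms by simp
  qed
  then show ?thesis by (simp add: slice_integral_def)
qed

text \<open>The slice at height \<open>z\<close> is a disc with squared radius \<open>1 + h - z\<^sup>2\<close>. The first term is the
  contribution of its rim, at \<open>\<bar>x\<bar>\<^sup>2 = 1 + h\<close>, the second one that of its centre on the axis.\<close>

lemma slice_integral_inside:
  assumes "e > 0" "z \<in> {0<..<sqrt 2}"
  obtains h where "0 < h" "z \<le> 1 \<Longrightarrow> z \<le> h" "z \<le> 1 \<Longrightarrow> h \<le> z * (1 - ln z)"
    "slice_integral e z = of_real pi *
      (d_eps e / ((d_eps e)\<^sup>2 - of_real (1 + h)) - d_eps e / ((d_eps e)\<^sup>2 - of_real (z\<^sup>2)))"
proof -
  obtain h where h: "0 < h" "z < 1 \<Longrightarrow> z \<le> h" "z < 1 \<Longrightarrow> h \<le> z * (1 - ln z)" "1 \<le> z \<Longrightarrow> h = 1"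
    "\<And>u. (u < 1 \<and> profile u < z) \<longleftrightarrow> u < h"
    using profile_sublevel[of z] assms by auto
  let ?c = "(d_eps e)\<^sup>2 - of_real (z\<^sup>2)"
  let ?R = "1 + h - z\<^sup>2"
  have "z\<^sup>2 < (sqrt 2)\<^sup>2" using assms by (intro power_strict_mono) auto
  then have z2: "z\<^sup>2 < 2" by simp
  have R: "0 \<le> ?R"
  proof (cases "z < 1")
    case True
    then have "z\<^sup>2 \<le> 1" using assms by (simp add: power_le_one)
    then show ?thesis using h by linarith
  qed (use h z2 in auto)
  have mem: "vec3 (z, y) \<in> log_region \<longleftrightarrow> (norm y)\<^sup>2 < ?R" for y
    using h(5)[of "z\<^sup>2 + (norm y)\<^sup>2 - 1"] by (auto simp: log_region_def norm_vec3_sq)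
  have "slice_integral e z =
      (LINT y:{y :: real \<times> real. (norm y)\<^sup>2 < ?R}|lborel. d_eps e / (?c - of_real ((norm y)\<^sup>2))\<^sup>2)"
    unfolding slice_integral_def set_lebesgue_integral_def
    by (rule Bochner_Integration.integral_cong)
       (auto simp: indicator_def mem dV_density_def norm_vec3_sq diff_diff_add)
  also have "\<dots> = of_real pi * (d_eps e / (?c - of_real ?R) - d_eps e / ?c)"
    by (rule inverse_square_integral_disc[OF _ R]) (unfold d_eps_sq_minus, use assms(1) in simp)
  also have "?c - of_real ?R = (d_eps e)\<^sup>2 - of_real (1 + h)" by simp
  finally have s: "slice_integral e z = of_real pi * (d_eps e / ((d_eps e)\<^sup>2 - of_real (1 + h)) - d_eps e / ?c)" .
  have "z \<le> h" "h \<le> z * (1 - ln z)" if "z \<le> 1"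
    using h that by (cases "z = 1"; simp)+
  then show ?thesis using that[OF h(1) _ _ s] by blast
qed

lemma Re_rim_term:
  assumes "e > 0"
  shows "Re (d_eps e / ((d_eps e)\<^sup>2 - of_real (1 + h))) = - (h - e\<^sup>2) / ((h + e\<^sup>2)\<^sup>2 + 4 * e\<^sup>2)"
  unfolding d_eps_sq_minus Re_divide complex.sel
  by (rule arg_cong2[where f = "(/)"]) (simp_all add: d_eps_def power2_eq_square algebra_simps)

lemma Re_rim_term_le:
  assumes "e > 0" "h > 0"
  shows "Re (d_eps e / ((d_eps e)\<^sup>2 - of_real (1 + h))) \<le> 1/4"
proof -
  have "0 < (h + e\<^sup>2)\<^sup>2 + 4 * e\<^sup>2" using assms by (simp add: add_nonneg_pos)
  moreover have "- (h * 4) \<le> (h + e\<^sup>2)\<^sup>2"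
    using assms zero_le_power2[of "h + e\<^sup>2"] by linarith
  ultimately show ?thesis
    unfolding Re_rim_term[OF assms(1)] using assms by (simp add: divide_le_eq)
qed

text \<open>Once \<open>h\<close> exceeds \<open>\<epsilon>\<close>, the rim term behaves like \<open>- 1 / h\<close>; it is used with
  \<open>k = z (1 - ln z)\<close>, the bound on the inverse profile.\<close>

lemma Re_rim_term_le_log:
  assumes e: "e > 0" "e \<le> 1/2" and h: "e \<le> h" "h \<le> k"
  shows "Re (d_eps e / ((d_eps e)\<^sup>2 - of_real (1 + h))) \<le> - (1 / (16 * k))"
proof -
  have e2: "e\<^sup>2 \<le> e / 2" using e by (simp add: power2_eq_square)
  have h0: "h > 0" using assms by simp
  have "(h + e\<^sup>2)\<^sup>2 \<le> (2 * h)\<^sup>2" using e2 h e by (intro power_mono) auto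
  moreover have "e\<^sup>2 \<le> h\<^sup>2" using h e by (intro power_mono) auto
  ultimately have D: "(h + e\<^sup>2)\<^sup>2 + 4 * e\<^sup>2 \<le> 8 * h\<^sup>2" by (simp add: power_mult_distrib)
  have "1 / (16 * k) \<le> 1 / (16 * h)" using h h0 by (intro divide_left_mono) auto
  also have "\<dots> = (h / 2) / (8 * h\<^sup>2)" using h0 by (simp add: power2_eq_square)
  also have "\<dots> \<le> (h - e\<^sup>2) / ((h + e\<^sup>2)\<^sup>2 + 4 * e\<^sup>2)"
    using D e2 h h0 e by (intro frac_le) (auto simp: add_nonneg_pos)
  finally show ?thesis unfolding Re_rim_term[OF e(1)] minus_divide_left[symmetric] by simp
qed

text \<open>In the partial fractions of \<open>d / (d\<^sup>2 - z\<^sup>2)\<close>, only \<open>1 / (d - z)\<close> is singular, at the north pole.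
  Its real part is odd about \<open>z = 1\<close> and stays bounded when integrated across the pole, even though
  its integral up to the pole diverges.\<close>

lemma Re_axis_term_ge:
  assumes "e > 0" "z \<ge> 0"
  shows "- Re (d_eps e / ((d_eps e)\<^sup>2 - of_real (z\<^sup>2))) \<le> (z - 1) / ((z - 1)\<^sup>2 + e\<^sup>2) / 2"
proof -
  let ?d = "d_eps e" and ?z = "complex_of_real z"
  define q where "q = (z - 1) / ((z - 1)\<^sup>2 + e\<^sup>2)"
  have nz: "?d - ?z \<noteq> 0" "?d + ?z \<noteq> 0"
    using assms by (auto simp: d_eps_def complex_eq_iff)
  have "?d\<^sup>2 - ?z\<^sup>2 = (?d - ?z) * (?d + ?z)" by (simp add: power2_eq_square algebra_simps)
  then have "?d / (?d\<^sup>2 - of_real (z\<^sup>2)) = (1 / (?d - ?z) + 1 / (?d + ?z)) / 2"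
    using nz by (simp add: divide_simps)
  then have "Re (?d / (?d\<^sup>2 - of_real (z\<^sup>2))) = (Re (1 / (?d - ?z)) + Re (1 / (?d + ?z))) / 2"
    by (simp only: Re_divide_numeral plus_complex.sel)
  moreover have "Re (1 / (?d - ?z)) = - q"
  proof -
    have "Re (1 / (?d - ?z)) = (1 - z) / ((z - 1)\<^sup>2 + e\<^sup>2)"
      by (simp add: Re_divide d_eps_def power2_commute)
    also have "\<dots> = - q" unfolding q_def minus_divide_left by simp
    finally show ?thesis .
  qed
  moreover have "Re (1 / (?d + ?z)) \<ge> 0"
    using assms by (simp add: Re_divide d_eps_def)
  moreover have "x = (y + w) / 2 \<Longrightarrow> y = - q \<Longrightarrow> 0 \<le> w \<Longrightarrow> - x \<le> q / 2" for x y w :: real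
    by simp
  ultimately show ?thesis unfolding q_def[symmetric] by blast
qed

lemma majorant_has_integral:
  fixes e :: real
  assumes e: "e > 0" "e \<le> 1"
  shows "((\<lambda>z. 1/4 + (z - 1) / ((z - 1)\<^sup>2 + e\<^sup>2) / 2 - (if z \<in> {e..1} then 1 / (16 * (z * (1 - ln z))) else 0))
    has_integral (sqrt 2 / 4 + (ln ((sqrt 2 - 1)\<^sup>2 + e\<^sup>2) / 4 - ln (1 + e\<^sup>2) / 4) - ln (1 - ln e) / 16))
    {0..sqrt 2}"
proof -
  have 1: "((\<lambda>z::real. 1/4) has_integral (sqrt 2 / 4)) {0..sqrt 2}"
    using has_integral_const_real[of "1/4::real" 0 "sqrt 2"] by simp
  have pos: "(z - 1)\<^sup>2 + e\<^sup>2 > 0" for z using e by (simp add: add_nonneg_pos)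
  have "((\<lambda>z. (z - 1) / ((z - 1)\<^sup>2 + e\<^sup>2) / 2) has_integral
      (ln ((sqrt 2 - 1)\<^sup>2 + e\<^sup>2) / 4 - ln ((0 - 1)\<^sup>2 + e\<^sup>2) / 4)) {0..sqrt 2}"
  proof (rule fundamental_theorem_of_calculus)
    fix z assume "z \<in> {0..sqrt 2}"
    have "((\<lambda>z. ln ((z - 1)\<^sup>2 + e\<^sup>2)) has_real_derivative 2 * (z - 1) / ((z - 1)\<^sup>2 + e\<^sup>2))
        (at z within {0..sqrt 2})"
      using pos[of z] by (auto intro!: derivative_eq_intros)
    moreover have "2 * a / b / 4 = a / b / 2" for a b :: real by simp
    ultimately show "((\<lambda>z. ln ((z - 1)\<^sup>2 + e\<^sup>2) / 4) has_vector_derivative (z - 1) / ((z - 1)\<^sup>2 + e\<^sup>2) / 2)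
        (at z within {0..sqrt 2})"
      unfolding has_real_derivative_iff_has_vector_derivative[symmetric]
      using DERIV_cdivide[of _ _ z "{0..sqrt 2}" 4] by metis
  qed simp
  then have 2: "((\<lambda>z. (z - 1) / ((z - 1)\<^sup>2 + e\<^sup>2) / 2) has_integral
      (ln ((sqrt 2 - 1)\<^sup>2 + e\<^sup>2) / 4 - ln (1 + e\<^sup>2) / 4)) {0..sqrt 2}"
    by simp
  have "((\<lambda>z. 1 / (16 * (z * (1 - ln z)))) has_integral (- ln (1 - ln 1) / 16 - - ln (1 - ln e) / 16)) {e..1}"
  proof (rule fundamental_theorem_of_calculus)
    fix z assume z: "z \<in> {e..1}"
    then have "z > 0" "z \<le> 1" using e by auto
    then have "1 - ln z > 0" using ln_le_zero_iff[of z] by linarith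
    then show "((\<lambda>z. - ln (1 - ln z) / 16) has_vector_derivative 1 / (16 * (z * (1 - ln z)))) (at z within {e..1})"
      using \<open>z > 0\<close>
      by (auto intro!: derivative_eq_intros simp: divide_simps simp flip: has_real_derivative_iff_has_vector_derivative)
  qed (use e in auto)
  then have "((\<lambda>z. if z \<in> {e..1} then 1 / (16 * (z * (1 - ln z))) else 0) has_integral (ln (1 - ln e) / 16)) {0..sqrt 2}"
    using e by (subst has_integral_restrict) auto
  from has_integral_diff[OF has_integral_add[OF 1 2] this] show ?thesis .
qed

text \<open>The two logarithms coming from the axis have a difference \<open>\<le> 0\<close> because the slices extend to
  height \<open>\<surd>2\<close>, which is at most as far beyond the pole as the pole is from the equator.\<close>

lemma Re_vol_eps_le:
  assumes e: "e > 0" "e \<le> 1/2"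
  shows "Re (vol_eps e log_region) \<le> pi * (1 - ln (1 - ln e) / 16)"
proof -
  let ?S = "{0<..<sqrt 2}"
  let ?B = "\<lambda>z. 1/4 + (z - 1) / ((z - 1)\<^sup>2 + e\<^sup>2) / 2 - (if z \<in> {e..1} then 1 / (16 * (z * (1 - ln z))) else 0)"
  let ?I = "sqrt 2 / 4 + (ln ((sqrt 2 - 1)\<^sup>2 + e\<^sup>2) / 4 - ln (1 + e\<^sup>2) / 4) - ln (1 - ln e) / 16"
  have int: "integrable lborel (slice_integral e)"
    and vol: "vol_eps e log_region = (LINT z|lborel. slice_integral e z)"
    using integral_vec3[OF dV_integrable[OF e(1)]]
    unfolding vol_eps_def set_lebesgue_integral_def slice_integral_def[abs_def] by auto
  have "((\<lambda>z. Re (slice_integral e z)) has_integral (LINT z|lborel. Re (slice_integral e z))) UNIV"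
    using int by (intro has_integral_integral_lborel) simp
  also have "(LINT z|lborel. Re (slice_integral e z)) = Re (vol_eps e log_region)"
    using int by (simp add: vol)
  finally have "((\<lambda>z. if z \<in> ?S then Re (slice_integral e z) else 0)
      has_integral Re (vol_eps e log_region)) UNIV"
    by (rule has_integral_eq[rotated]) (use slice_integral_outside in auto)
  then have slices: "((\<lambda>z. Re (slice_integral e z)) has_integral Re (vol_eps e log_region)) ?S"
    by (rule has_integral_restrict_UNIV[THEN iffD1])
  have "(?B has_integral ?I) ?S"
    using majorant_has_integral[of e] e by (simp add: has_integral_Icc_iff_Ioo)
  then have majorant: "((\<lambda>z. pi * ?B z) has_integral (pi * ?I)) ?S"
    by (rule has_integral_mult_right)
  have "Re (vol_eps e log_region) \<le> pi * ?I"
  proof (rule has_integral_le[OF slices majorant])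
    fix z assume z: "z \<in> ?S"
    obtain h where h: "0 < h" "z \<le> 1 \<Longrightarrow> z \<le> h" "z \<le> 1 \<Longrightarrow> h \<le> z * (1 - ln z)"
      and s: "slice_integral e z = of_real pi *
      (d_eps e / ((d_eps e)\<^sup>2 - of_real (1 + h)) - d_eps e / ((d_eps e)\<^sup>2 - of_real (z\<^sup>2)))"
      using slice_integral_inside[OF e(1) z] by blast
    let ?rim = "Re (d_eps e / ((d_eps e)\<^sup>2 - of_real (1 + h)))"
    let ?ax = "Re (d_eps e / ((d_eps e)\<^sup>2 - of_real (z\<^sup>2)))"
    have "?rim \<le> 1/4 - (if z \<in> {e..1} then 1 / (16 * (z * (1 - ln z))) else 0)"
      using Re_rim_term_le[OF e(1) h(1)] Re_rim_term_le_log[OF e, of h "z * (1 - ln z)"] h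
      by (cases "z \<in> {e..1}") auto
    moreover have "- ?ax \<le> (z - 1) / ((z - 1)\<^sup>2 + e\<^sup>2) / 2"
      using Re_axis_term_ge[OF e(1)] z by simp
    ultimately have "?rim - ?ax \<le> ?B z" by linarith
    then have "pi * (?rim - ?ax) \<le> pi * ?B z" by (intro mult_left_mono) auto
    moreover have "Re (slice_integral e z) = pi * (?rim - ?ax)"
      by (simp only: s times_complex.sel minus_complex.sel Re_complex_of_real Im_complex_of_real
          mult_zero_left diff_zero)
    ultimately show "Re (slice_integral e z) \<le> pi * ?B z" by simp
  qed
  also have "?I \<le> 1 - ln (1 - ln e) / 16"
  proof -
    have s2: "1 < sqrt 2" "sqrt 2 < 2" by (auto intro: real_less_lsqrt)
    then have "(sqrt 2 - 1)\<^sup>2 \<le> 1" by (intro power_le_one) auto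
    moreover have "0 < (sqrt 2 - 1)\<^sup>2 + e\<^sup>2" using e by (simp add: add_nonneg_pos)
    ultimately have "ln ((sqrt 2 - 1)\<^sup>2 + e\<^sup>2) \<le> ln (1 + e\<^sup>2)" by (intro ln_mono) auto
    then show ?thesis using s2 by linarith
  qed
  finally show ?thesis by simp
qed

lemma infinite_volume_log_region: "infinite_volume log_region"
  unfolding infinite_volume_def
proof (rule filterlim_at_top_mono)
  have "filterlim (\<lambda>e::real. 1 + - ln e) at_top (at_right 0)"
    by (intro filterlim_tendsto_add_at_top[OF tendsto_const]
        filterlim_compose[OF filterlim_uminus_at_top_at_bot] ln_at_0)
  then have "filterlim (\<lambda>e::real. ln (1 + - ln e)) at_top (at_right 0)"
    by (rule filterlim_compose[OF ln_at_top])
  then have "filterlim (\<lambda>e::real. - pi + (pi / 16) * ln (1 + - ln e)) at_top (at_right 0)"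
    by (intro filterlim_tendsto_add_at_top[OF tendsto_const]
        filterlim_tendsto_pos_mult_at_top[OF tendsto_const]) auto
  then show "filterlim (\<lambda>e::real. pi * (ln (1 - ln e) / 16 - 1)) at_top (at_right 0)"
    by (simp add: algebra_simps)
  have "\<forall>\<^sub>F e in at_right 0. e \<in> {0<..<1/2::real}"
    by (rule eventually_at_right_real) simp
  then show "\<forall>\<^sub>F e in at_right 0. pi * (ln (1 - ln e) / 16 - 1) \<le> norm (vol_eps e log_region)"
  proof eventually_elim
    case (elim e)
    have "pi * (ln (1 - ln e) / 16 - 1) \<le> - Re (vol_eps e log_region)"
      using Re_vol_eps_le[of e] elim by (simp add: algebra_simps)
    also have "\<dots> \<le> norm (vol_eps e log_region)"
      using abs_Re_le_cmod[of "vol_eps e log_region"] by linarith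
    finally show ?case .
  qed
qed

theorem mainTheorem5:
  "\<exists>U :: K3 set. domain_K3 U \<and> C1_transversal U \<and> infinite_volume U"
  using domain_log_region C1_transversal_log_region infinite_volume_log_region by blast

end
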